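(* Let $\alpha,\beta>-1$ be real, and for a constant $c$ and $m\ge1$ let $P^{(\alpha,\beta)}_{m;c}(x)=P^{(\alpha,\beta)}_m(x)+c\,P^{(\alpha,\beta)}_{m-1}(x)$. Let $n\ge2$ be an integer and let $s,t$ be constants. Then \[ \begin{aligned} \operatorname{Res}(P^{(\alpha,\beta)}_{n;s},P^{(\alpha,\beta)}_{n-1;t}) &=\frac{(-1)^{n(n+1)/2}(2n+\alpha+\beta)^{n-2}(2n+\alpha+\beta-1)^n(2n+\alpha+\beta-2)^n}{2^{n(n-1)}(n+\alpha-1)^n(n+\beta-1)^n}\\ &\quad\cdot\prod_{k=1}^nk^{k-2n+2}\prod_{k=1}^{n-1}(k+\alpha)^k(k+\beta)^k(n+k+\alpha+\beta)^{n-k-2}\\ &\quad\cdot t^nP^{(\alpha,\beta)}_{n;s}\biggl(-\frac{2(n+\alpha-1)(n+\beta-1)}{(2n+\alpha+\beta-1)(2n+\alpha+\beta-2)t}\\ &\qquad-\frac{\alpha^2-\beta^2}{(2n+\alpha+\beta)(2n+\alpha+\beta-2)}-\frac{2n(n+\alpha+\beta)s}{(2n+\alpha+\beta)(2n+\alpha+\beta-1)}\biggr). \end{aligned} \] In particular, if $t=0$, then \[ \operatorname{Res}(P^{(\alpha,\beta)}_{n;s},P^{(\alpha,\beta)}_{n-1})=\frac{(-1)^{n(n-1)/2}(2n+\alpha+\beta)^{n-1}}{2^{n(n-1)}}\prod_{k=1}^nk^{k-2n+1}\cdot\prod_{k=1}^{n-1}(k+\alpha)^k(k+\beta)^k(n+k+\alpha+\beta)^{n-k-1}.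 \]
   Context: $P^{(\alpha,\beta)}_n$ is the $n$-th Jacobi polynomial, $P^{(\alpha,\beta)}_n(x)=\frac{(-1)^n}{2^nn!}(1-x)^{-\alpha}(1+x)^{-\beta}\frac{d^n}{dx^n}\left((1-x)^{n+\alpha}(1+x)^{n+\beta}\right)=\sum_{m=0}^n\binom{n+\alpha}{m}\binom{n+\beta}{n-m}\left(\frac{x-1}{2}\right)^{n-m}\left(\frac{x+1}{2}\right)^m$. Constants are real or complex numbers. For $f=a_0\prod_{i=1}^n(x-\alpha_i)$ of degree $n$ and $g=b_0\prod_{j=1}^m(x-\beta_j)$ of degree $m$, $\operatorname{Res}(f,g)=a_0^mb_0^n\prod_{i,j}(\alpha_i-\beta_j)$. The last factor $t^nP^{(\alpha,\beta)}_{n;s}(\cdots)$ in the first formula is a polynomial in $t$; at $t=0$ it denotes the value of that polynomial. *)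

theory Defs
  imports "HOL-Analysis.Analysis" "HOL-Computational_Algebra.Fundamental_Theorem_Algebra"
begin

section \<open>Jacobi polynomials\<close>

definition jacobi :: "'a::field_char_0 \<Rightarrow> 'a \<Rightarrow> nat \<Rightarrow> 'a poly" where
  "jacobi \<alpha> \<beta> n = (\<Sum>m\<le>n. smult (((of_nat n + \<alpha>) gchoose m) * ((of_nat n + \<beta>) gchoose (n - m)))
      ([:- 1/2, 1/2:] ^ (n - m) * [:1/2, 1/2:] ^ m))"

text \<open>Only meaningful for \<open>n \<ge> 1\<close>: at \<open>n = 0\<close> the natural-number subtraction truncates.\<close>
definition quasi_jacobi :: "'a::field_char_0 \<Rightarrow> 'a \<Rightarrow> 'a \<Rightarrow> nat \<Rightarrow> 'a poly" where
  "quasi_jacobi \<alpha> \<beta> c n = jacobi \<alpha> \<beta> n + smult c (jacobi \<alpha> \<beta> (n - 1))"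

lemma poly_jacobi:
  "poly (jacobi \<alpha> \<beta> n) x = (\<Sum>m\<le>n. ((of_nat n + \<alpha>) gchoose m) * ((of_nat n + \<beta>) gchoose (n - m))
      * ((x - 1) / 2) ^ (n - m) * ((x + 1) / 2) ^ m)"
  by (simp add: jacobi_def poly_sum diff_divide_distrib add_divide_distrib algebra_simps)

text \<open>The sum agrees with Rodrigues' formula.\<close>

lemma gchoose_Suc_mult:
  "of_nat (Suc k) * (a gchoose Suc k) = (a - of_nat k) * (a gchoose k)" for a :: "'a::field_char_0"
  by (metis gbinomial_absorb_comp gbinomial_absorption)

lemma higher_deriv_powr_product:
  fixes a b x :: real
  assumes "\<bar>x\<bar> < 1"
  shows "(deriv ^^ k) (\<lambda>y. (1 - y) powr a * (1 + y) powr b) x =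
    fact k * (\<Sum>m\<le>k. (-1) ^ m * (a gchoose m) * (b gchoose (k - m))
      * (1 - x) powr (a - real m) * (1 + x) powr (b - real (k - m)))"
  using assms
proof (induction k arbitrary: x)
  case 0
  then show ?case by simp
next
  case (Suc k)
  define A where "A m y = (-1) ^ m * (a gchoose m) * (1 - y) powr (a - real m)" for m and y :: real
  define B where "B m y = (b gchoose m) * (1 + y) powr (b - real m)" for m and y :: real
  have dA: "(A m has_real_derivative real (Suc m) * A (Suc m) x) (at x)" for m
  proof -
    have "(A m has_real_derivative
        ((-1) ^ m * (a gchoose m)) * (- ((a - real m) * (1 - x) powr (a - real m - 1)))) (at x)"
      unfolding A_def using Suc.prems by (auto intro!: derivative_eq_intros)
    moreover have "((-1) ^ m * (a gchoose m)) * (- ((a - real m) * (1 - x) powr (a - real m - 1)))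
      = real (Suc m) * A (Suc m) x"
    proof -
      have "real (Suc m) * A (Suc m) x
          = (-1) ^ Suc m * (real (Suc m) * (a gchoose Suc m)) * (1 - x) powr (a - real m - 1)"
        unfolding A_def by (simp add: algebra_simps)
      then show ?thesis unfolding gchoose_Suc_mult by (simp add: algebra_simps)
    qed
    ultimately show ?thesis by simp
  qed
  have dB: "(B m has_real_derivative real (Suc m) * B (Suc m) x) (at x)" for m
  proof -
    have "(B m has_real_derivative (b gchoose m) * ((b - real m) * (1 + x) powr (b - real m - 1))) (at x)"
      unfolding B_def using Suc.prems by (auto intro!: derivative_eq_intros)
    moreover have "(b gchoose m) * ((b - real m) * (1 + x) powr (b - real m - 1))
      = real (Suc m) * B (Suc m) x"
    proof -
      have "real (Suc m) * B (Suc m) x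
          = (real (Suc m) * (b gchoose Suc m)) * (1 + x) powr (b - real m - 1)"
        unfolding B_def by (simp add: algebra_simps)
      then show ?thesis unfolding gchoose_Suc_mult by (simp add: algebra_simps)
    qed
    ultimately show ?thesis by simp
  qed
  have "eventually (\<lambda>y. y \<in> {-1<..<1}) (nhds x)"
    by (rule eventually_nhds_in_open) (use Suc.prems in auto)
  then have ev: "eventually (\<lambda>y. (deriv ^^ k) (\<lambda>y. (1 - y) powr a * (1 + y) powr b) y
      = fact k * (\<Sum>m\<le>k. A m y * B (k - m) y)) (nhds x)"
    by eventually_elim (subst Suc.IH, auto simp: A_def B_def algebra_simps)
  have "((\<lambda>y. fact k * (\<Sum>m\<le>k. A m y * B (k - m) y)) has_real_derivative
      fact k * (\<Sum>m\<le>k. A m x * (real (Suc (k - m)) * B (Suc (k - m)) x)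
        + real (Suc m) * A (Suc m) x * B (k - m) x)) (at x)"
    by (intro DERIV_cmult DERIV_sum DERIV_mult' dA dB)
  then have "(deriv ^^ Suc k) (\<lambda>y. (1 - y) powr a * (1 + y) powr b) x =
      fact k * (\<Sum>m\<le>k. A m x * (real (Suc (k - m)) * B (Suc (k - m)) x)
        + real (Suc m) * A (Suc m) x * B (k - m) x)"
    using deriv_cong_ev[OF ev refl] by (simp add: DERIV_imp_deriv)
  also have "(\<Sum>m\<le>k. A m x * (real (Suc (k - m)) * B (Suc (k - m)) x)
        + real (Suc m) * A (Suc m) x * B (k - m) x)
    = (\<Sum>m\<le>Suc k. real (Suc k - m) * (A m x * B (Suc k - m) x))
      + (\<Sum>m\<le>Suc k. real m * (A m x * B (Suc k - m) x))"
  proof -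
    have "(\<Sum>m\<le>Suc k. real m * (A m x * B (Suc k - m) x))
        = (\<Sum>m\<le>k. real (Suc m) * A (Suc m) x * B (k - m) x)"
      by (subst sum.atMost_Suc_shift) (simp add: mult.assoc)
    moreover have "(\<Sum>m\<le>Suc k. real (Suc k - m) * (A m x * B (Suc k - m) x))
        = (\<Sum>m\<le>k. A m x * (real (Suc (k - m)) * B (Suc (k - m)) x))"
      by (simp, intro sum.cong) (auto simp: Suc_diff_le)
    ultimately show ?thesis by (simp add: sum.distrib)
  qed
  also have "\<dots> = real (Suc k) * (\<Sum>m\<le>Suc k. A m x * B (Suc k - m) x)"
    unfolding sum_distrib_left sum.distrib[symmetric]
    by (intro sum.cong refl) (auto simp: of_nat_diff algebra_simps)
  finally have "(deriv ^^ Suc k) (\<lambda>y. (1 - y) powr a * (1 + y) powr b) x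
      = fact (Suc k) * (\<Sum>m\<le>Suc k. A m x * B (Suc k - m) x)"
    by (simp add: mult.assoc mult.left_commute del: sum.atMost_Suc)
  then show ?case
    by (simp only: A_def B_def mult.assoc mult.left_commute mult.commute)
qed

lemma jacobi_rodrigues:
  fixes \<alpha> \<beta> x :: real
  assumes x: "\<bar>x\<bar> < 1"
  shows "poly (jacobi \<alpha> \<beta> n) x = (-1) ^ n / (2 ^ n * fact n) * (1 - x) powr (- \<alpha>) * (1 + x) powr (- \<beta>)
    * (deriv ^^ n) (\<lambda>y. (1 - y) powr (real n + \<alpha>) * (1 + y) powr (real n + \<beta>)) x"
  unfolding poly_jacobi higher_deriv_powr_product[OF x] sum_distrib_left
proof (rule sum.cong[OF refl], goal_cases)
  case (1 m)
  define j where "j = n - m"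
  have n: "n = m + j" using 1 by (simp add: j_def)
  have pos: "1 - x > 0" "1 + x > 0" using x by auto
  have "(1 - x) powr (real n + \<alpha> - real m) = (1 - x) ^ j * (1 - x) powr \<alpha>"
    using pos by (simp add: n powr_add powr_realpow)
  moreover have "(1 + x) powr (real n + \<beta> - real j) = (1 + x) ^ m * (1 + x) powr \<beta>"
    using pos by (simp add: n powr_add powr_realpow)
  moreover have "(x - 1) ^ j = (-1) ^ j * (1 - x) ^ j"
    by (simp flip: power_mult_distrib)
  ultimately show ?case
    unfolding j_def[symmetric] using pos
    by (simp add: n power_divide power_add powr_minus field_simps flip: power_mult_distrib)
qed

section \<open>Resultants\<close>

text \<open>Roots are counted with multiplicity. Over the complex numbers every polynomial splits, so
  these are all the roots; see \<open>Res_split\<close> for split polynomials with listed roots.\<close>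
definition Res :: "complex poly \<Rightarrow> complex poly \<Rightarrow> complex" where
  "Res f g = lead_coeff f ^ degree g * lead_coeff g ^ degree f *
     (\<Prod>a\<in>#proots f. \<Prod>b\<in>#proots g. a - b)"

lemma proots_split:
  assumes "c \<noteq> (0::complex)" "finite I"
  shows "proots (smult c (\<Prod>i\<in>I. [:- a i, 1:])) = image_mset a (mset_set I)"
    "lead_coeff (smult c (\<Prod>i\<in>I. [:- a i, 1:])) = c"
    "degree (smult c (\<Prod>i\<in>I. [:- a i, 1:])) = card I"
proof -
  have "proots (\<Prod>i\<in>I. [:- a i, 1:]) = (\<Sum>i\<in>I. {#a i#})"
    by (subst proots_prod) auto
  also have "\<dots> = image_mset a (mset_set I)"
    using assms(2) by (induction I rule: finite_induct) auto
  finally show "proots (smult c (\<Prod>i\<in>I. [:- a i, 1:])) = image_mset a (mset_set I)"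
    using assms by simp
  show "lead_coeff (smult c (\<Prod>i\<in>I. [:- a i, 1:])) = c"
    by (simp add: lead_coeff_prod)
  show "degree (smult c (\<Prod>i\<in>I. [:- a i, 1:])) = card I"
    using assms by (simp add: degree_prod_eq_sum_degree)
qed

lemma Res_split:
  assumes "a0 \<noteq> 0" "b0 \<noteq> 0"
  shows "Res (smult a0 (\<Prod>i=1..n. [:- a i, 1:])) (smult b0 (\<Prod>j=1..m. [:- b j, 1:]))
    = a0 ^ m * b0 ^ n * (\<Prod>i=1..n. \<Prod>j=1..m. a i - b j)"
  unfolding Res_def proots_split(2)[OF assms(1) finite_atLeastAtMost]
    proots_split(2)[OF assms(2) finite_atLeastAtMost]
  unfolding proots_split(1,3)[OF assms(1) finite_atLeastAtMost]
    proots_split(1,3)[OF assms(2) finite_atLeastAtMost]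
  by (simp add: image_mset.compositionality o_def flip: prod_unfold_prod_mset)

section \<open>Polynomial continuation to the origin\<close>

text \<open>For \<open>f\<close> that agrees with a polynomial away from 0, this is that (unique) polynomial;
  otherwise it is unspecified.\<close>
definition poly_extension :: "(complex \<Rightarrow> complex) \<Rightarrow> complex poly" where
  "poly_extension f = (THE q. \<forall>u. u \<noteq> 0 \<longrightarrow> poly q u = f u)"

lemma poly_extension_eqI:
  assumes "\<And>u. u \<noteq> 0 \<Longrightarrow> poly q u = f u"
  shows "poly_extension f = q"
  unfolding poly_extension_def
proof (rule the_equality)
  fix p assume p: "\<forall>u. u \<noteq> 0 \<longrightarrow> poly p u = f u"
  show "p = q"
  proof (rule ccontr)
    assume "p \<noteq> q"
    then have "finite {u. poly (p - q) u = 0}"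
      by (intro poly_roots_finite) auto
    moreover have "UNIV - {0} \<subseteq> {u. poly (p - q) u = 0}"
      using p assms by auto
    ultimately have "finite (UNIV - {0::complex})"
      by (rule finite_subset[rotated])
    then show False
      by (simp add: infinite_UNIV_char_0)
  qed
qed (use assms in auto)

lemma poly_extension_homogenize:
  assumes "degree p \<le> n"
  shows "poly_extension (\<lambda>u. u ^ n * poly p (a / u + b))
    = (\<Sum>k\<le>n. smult (coeff p k) ([:a, b:] ^ k * monom 1 (n - k)))"
proof (rule poly_extension_eqI)
  fix u :: complex assume u: "u \<noteq> 0"
  have "poly p (a / u + b) = (\<Sum>k\<le>n. coeff p k * (a / u + b) ^ k)"
    unfolding poly_altdef using assms
    by (intro sum.mono_neutral_left) (auto simp: coeff_eq_0)
  moreover have "(a + u * b) ^ k * u ^ (n - k) = u ^ n * (a / u + b) ^ k" if "k \<le> n" for k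
  proof -
    have "a + u * b = u * (a / u + b)" using u by (simp add: field_simps)
    moreover have "u ^ n = u ^ k * u ^ (n - k)" using that by (simp flip: power_add)
    ultimately show ?thesis by (simp add: power_mult_distrib)
  qed
  ultimately show "poly (\<Sum>k\<le>n. smult (coeff p k) ([:a, b:] ^ k * monom 1 (n - k))) u
      = u ^ n * poly p (a / u + b)"
    by (simp add: poly_sum poly_monom sum_distrib_left mult.left_commute)
qed

end

theory Submission
  imports Defs
begin

text \<open>
  Write \<open>P n\<close> for the Jacobi polynomials, \<open>f = P n + s P (n - 1)\<close> and
  \<open>g = P (n - 1) + t P (n - 2)\<close>. The resultant of \<open>f\<close> and \<open>g\<close> is a power of the leading
  coefficient of \<open>f\<close> times the product of the values of \<open>g\<close> at the roots \<open>x\<close> of \<open>f\<close>. At such a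
  root \<open>P n x = - s P (n - 1) x\<close>, so the three-term recurrence (\<open>jacobi_recurrence\<close>) expresses
  \<open>P (n - 2) x\<close> as \<open>L x * P (n - 1) x\<close> with \<open>L\<close> affine. Hence \<open>g x = (1 + t L x) P (n - 1) x\<close>, and

  \<open>Res f g = Res f (P (n - 1)) * (\<Prod>x. 1 + t L x)\<close>.

  The zero of the affine function \<open>1 + t L\<close> is precisely the point at which the theorem evaluates \<open>f\<close>,
  so for \<open>t \<noteq> 0\<close> the product over the roots is that value of \<open>f\<close>, up to a power of \<open>t\<close> and a
  constant. Since the product is a polynomial in \<open>t\<close>, it also supplies the value at \<open>t = 0\<close>
  (\<open>poly_extension_affine\<close>).

  There remains \<open>Res f (P (n - 1))\<close>. Adding a multiple of \<open>P (n - 1)\<close> to \<open>P n\<close> does not change the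
  values at the roots of \<open>P (n - 1)\<close>, so this equals \<open>Res (P n) (P (n - 1))\<close> (\<open>Res_add_smult\<close>). At the
  roots of \<open>P (n - 1)\<close> the recurrence reads \<open>P n = c P (n - 2)\<close> with a constant \<open>c\<close>, which is
  Schur's reduction of the resultant to the one with \<open>n\<close> lowered by one (\<open>Res_jacobi_step\<close>). The
  closed formula follows by induction, with the leading coefficients taken from Vandermonde's identity.
\<close>

section \<open>The three-term recurrence\<close>

text \<open>
  With \<open>u = (x - 1) / 2\<close>, \<open>v = (x + 1) / 2\<close> and \<open>f = 1\<close> this is the explicit sum for the Jacobi
  polynomial, read as a binary form of degree \<open>n\<close>. Shifting the degree or the index changes its
  coefficients by rational factors in the index \<open>m\<close>; the weight \<open>f\<close> records them, and its argument
  is a field element so that such factors are polynomials in one variable.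
\<close>

definition weighted_jacobi_form ::
    "'a::field_char_0 \<Rightarrow> 'a \<Rightarrow> 'a \<Rightarrow> 'a \<Rightarrow> ('a \<Rightarrow> 'a) \<Rightarrow> nat \<Rightarrow> 'a" where
  "weighted_jacobi_form \<alpha> \<beta> u v f n = (\<Sum>m\<le>n. f (of_nat m) *
     (((of_nat n + \<alpha>) gchoose m) * ((of_nat n + \<beta>) gchoose (n - m)) * u ^ (n - m) * v ^ m))"

lemma poly_jacobi_eq_form:
  "poly (jacobi \<alpha> \<beta> n) x = weighted_jacobi_form \<alpha> \<beta> ((x - 1) / 2) ((x + 1) / 2) (\<lambda>_. 1) n"
  by (simp add: poly_jacobi weighted_jacobi_form_def)

text \<open>
  Multiplication by \<open>u\<close> or \<open>v\<close> turns a form of degree \<open>n\<close> into one of degree \<open>n + 1\<close>. The absorption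
  identities express the coefficients at \<open>n\<close> through those at \<open>n + 1\<close>, and not conversely: the
  factor in \<open>m\<close> then vanishes by itself at the index that has no counterpart (\<open>m = n + 1\<close> for \<open>u\<close>,
  \<open>m = 0\<close> for \<open>v\<close>), so no boundary cases arise.
\<close>

lemma weighted_jacobi_form_times_u:
  "(of_nat (Suc n) + \<alpha>) * (of_nat (Suc n) + \<beta>) * (u * weighted_jacobi_form \<alpha> \<beta> u v f n) =
   weighted_jacobi_form \<alpha> \<beta> u v
     (\<lambda>m. f m * ((of_nat (Suc n) + \<alpha> - m) * (of_nat (Suc n) - m))) (Suc n)"
  (is "?A * ?B * _ = _")
proof -
  have "f (of_nat m) * ((?A - of_nat m) * (of_nat (Suc n) - of_nat m)) *
      ((?A gchoose m) * (?B gchoose (Suc n - m)) * u ^ (Suc n - m) * v ^ m) =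
    ?A * ?B * (u * (f (of_nat m) *
      (((of_nat n + \<alpha>) gchoose m) * ((of_nat n + \<beta>) gchoose (n - m)) * u ^ (n - m) * v ^ m)))"
    if m: "m \<le> n" for m
  proof -
    have 1: "(?A - of_nat m) * (?A gchoose m) = ?A * ((of_nat n + \<alpha>) gchoose m)"
      using gbinomial_absorb_comp[of ?A m] by (simp add: add_ac)
    have 2: "(of_nat (Suc n) - of_nat m) * (?B gchoose (Suc n - m)) = ?B * ((of_nat n + \<beta>) gchoose (n - m))"
      using gbinomial_absorption[of "n - m" ?B] m by (simp add: Suc_diff_le of_nat_diff algebra_simps)
    have "f (of_nat m) * ((?A - of_nat m) * (of_nat (Suc n) - of_nat m)) *
        ((?A gchoose m) * (?B gchoose (Suc n - m)) * u ^ (Suc n - m) * v ^ m) =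
      f (of_nat m) * (((?A - of_nat m) * (?A gchoose m)) *
        ((of_nat (Suc n) - of_nat m) * (?B gchoose (Suc n - m))) * u ^ (Suc n - m) * v ^ m)"
      by (simp only: mult_ac)
    then show ?thesis
      unfolding 1 2 using m by (simp add: Suc_diff_le mult_ac)
  qed
  then have "(\<Sum>m\<le>n. f (of_nat m) * ((?A - of_nat m) * (of_nat (Suc n) - of_nat m)) *
      ((?A gchoose m) * (?B gchoose (Suc n - m)) * u ^ (Suc n - m) * v ^ m)) =
    ?A * ?B * (u * weighted_jacobi_form \<alpha> \<beta> u v f n)"
    unfolding weighted_jacobi_form_def sum_distrib_left by (intro sum.cong) auto
  then show ?thesis
    unfolding weighted_jacobi_form_def[of _ _ _ _ _ "Suc n"] sum.atMost_Suc
    by (simp del: of_nat_Suc)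
qed

lemma weighted_jacobi_form_times_v:
  "(of_nat (Suc n) + \<alpha>) * (of_nat (Suc n) + \<beta>) * (v * weighted_jacobi_form \<alpha> \<beta> u v f n) =
   weighted_jacobi_form \<alpha> \<beta> u v (\<lambda>m. f (m - 1) * (m * (\<beta> + m))) (Suc n)"
  (is "?A * ?B * _ = _")
proof -
  have "f (of_nat (Suc m) - 1) * (of_nat (Suc m) * (\<beta> + of_nat (Suc m))) *
      ((?A gchoose Suc m) * (?B gchoose (n - m)) * u ^ (n - m) * v ^ Suc m) =
    ?A * ?B * (v * (f (of_nat m) *
      (((of_nat n + \<alpha>) gchoose m) * ((of_nat n + \<beta>) gchoose (n - m)) * u ^ (n - m) * v ^ m)))"
    if m: "m \<le> n" for m
  proof -
    have 1: "of_nat (Suc m) * (?A gchoose Suc m) = ?A * ((of_nat n + \<alpha>) gchoose m)"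
      using gbinomial_absorption[of m ?A] by (simp add: add_ac)
    have 2: "(\<beta> + of_nat (Suc m)) * (?B gchoose (n - m)) = ?B * ((of_nat n + \<beta>) gchoose (n - m))"
      using gbinomial_absorb_comp[of ?B "n - m"] m by (simp add: of_nat_diff add_ac)
    have "f (of_nat m) * (of_nat (Suc m) * (\<beta> + of_nat (Suc m))) *
        ((?A gchoose Suc m) * (?B gchoose (n - m)) * u ^ (n - m) * v ^ Suc m) =
      f (of_nat m) * ((of_nat (Suc m) * (?A gchoose Suc m)) *
        ((\<beta> + of_nat (Suc m)) * (?B gchoose (n - m))) * u ^ (n - m) * v ^ Suc m)"
      by (simp only: mult_ac)
    then show ?thesis
      unfolding 1 2 by (simp add: mult_ac)
  qed
  then have "(\<Sum>m\<le>n. f (of_nat (Suc m) - 1) * (of_nat (Suc m) * (\<beta> + of_nat (Suc m))) *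
      ((?A gchoose Suc m) * (?B gchoose (n - m)) * u ^ (n - m) * v ^ Suc m)) =
    ?A * ?B * (v * weighted_jacobi_form \<alpha> \<beta> u v f n)"
    unfolding weighted_jacobi_form_def sum_distrib_left by (intro sum.cong) auto
  then show ?thesis
    unfolding weighted_jacobi_form_def[of _ _ _ _ _ "Suc n"] sum.atMost_Suc_shift
    by (simp del: of_nat_Suc)
qed

lemma weighted_jacobi_form_add:
  "weighted_jacobi_form \<alpha> \<beta> u v f n + weighted_jacobi_form \<alpha> \<beta> u v g n =
   weighted_jacobi_form \<alpha> \<beta> u v (\<lambda>m. f m + g m) n"
  by (simp add: weighted_jacobi_form_def sum.distrib distrib_right)

lemma weighted_jacobi_form_cmult:
  "c * weighted_jacobi_form \<alpha> \<beta> u v f n = weighted_jacobi_form \<alpha> \<beta> u v (\<lambda>m. c * f m) n"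
  by (simp add: weighted_jacobi_form_def sum_distrib_left mult_ac)

text \<open>
  Because \<open>v - u = 1\<close> and \<open>x = u + v\<close>, every term can be made homogeneous of degree \<open>n + 2\<close> in \<open>u\<close>
  and \<open>v\<close>. Expressed through the coefficients of degree \<open>n + 2\<close>, the recurrence then holds
  coefficient by coefficient, as a polynomial identity in \<open>m\<close>, \<open>\<nu>\<close>, \<open>\<alpha>\<close> and \<open>\<beta>\<close>. The assumptions
  allow cancelling the factor \<open>(\<nu> + \<alpha>) (\<nu> + \<beta>)\<close> that this change of degree introduces.
\<close>

lemma jacobi_recurrence:
  fixes \<alpha> \<beta> x :: "'a::field_char_0" and n :: nat
  defines "\<nu> \<equiv> of_nat n + 2"
  assumes "\<nu> + \<alpha> \<noteq> 0" "\<nu> + \<beta> \<noteq> 0"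
  shows "2 * \<nu> * (\<nu> + \<alpha> + \<beta>) * (2 * \<nu> + \<alpha> + \<beta> - 2) * poly (jacobi \<alpha> \<beta> (n + 2)) x =
      (2 * \<nu> + \<alpha> + \<beta> - 1) * ((2 * \<nu> + \<alpha> + \<beta>) * (2 * \<nu> + \<alpha> + \<beta> - 2) * x + \<alpha>\<^sup>2 - \<beta>\<^sup>2)
        * poly (jacobi \<alpha> \<beta> (n + 1)) x
    - 2 * (\<nu> + \<alpha> - 1) * (\<nu> + \<beta> - 1) * (2 * \<nu> + \<alpha> + \<beta>) * poly (jacobi \<alpha> \<beta> n) x"
proof -
  define u v where "u = (x - 1) / 2" and "v = (x + 1) / 2"
  have uv: "v - u = 1" "x = u + v"
    by (simp_all add: u_def v_def field_simps)
  define W where "W = weighted_jacobi_form \<alpha> \<beta> u v"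
  define D E where "D = (\<nu> + \<alpha>) * (\<nu> + \<beta>)" and "E = (\<nu> + \<alpha> - 1) * (\<nu> + \<beta> - 1)"
  have nu: "of_nat (Suc (Suc n)) = \<nu>" "of_nat (Suc n) = \<nu> - 1"
    by (simp_all add: \<nu>_def)
  have u2: "D * (u * W f (n + 1)) = W (\<lambda>m. f m * ((\<nu> + \<alpha> - m) * (\<nu> - m))) (n + 2)"
    and v2: "D * (v * W f (n + 1)) = W (\<lambda>m. f (m - 1) * (m * (\<beta> + m))) (n + 2)" for f
    using weighted_jacobi_form_times_u[of "Suc n" \<alpha> \<beta> u v f]
      weighted_jacobi_form_times_v[of "Suc n" \<alpha> \<beta> v u f]
    unfolding nu W_def D_def by simp_all
  have u1: "E * (u * W f n) = W (\<lambda>m. f m * ((\<nu> - 1 + \<alpha> - m) * (\<nu> - 1 - m))) (n + 1)"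
    and v1: "E * (v * W f n) = W (\<lambda>m. f (m - 1) * (m * (\<beta> + m))) (n + 1)" for f
    using weighted_jacobi_form_times_u[of n \<alpha> \<beta> u v f]
      weighted_jacobi_form_times_v[of n \<alpha> \<beta> v u f]
    unfolding nu W_def E_def by (simp_all add: algebra_simps)
  define a where "a = 2 * \<nu> * (\<nu> + \<alpha> + \<beta>) * (2 * \<nu> + \<alpha> + \<beta> - 2)"
  define b where "b = (2 * \<nu> + \<alpha> + \<beta> - 1) * ((2 * \<nu> + \<alpha> + \<beta>) * (2 * \<nu> + \<alpha> + \<beta> - 2))"
  define d where "d = (2 * \<nu> + \<alpha> + \<beta> - 1) * (\<alpha>\<^sup>2 - \<beta>\<^sup>2)"
  define e where "e = 2 * (2 * \<nu> + \<alpha> + \<beta>)"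
  define P where "P k = poly (jacobi \<alpha> \<beta> k) x" for k
  have P: "P k = W (\<lambda>_. 1) k" for k
    by (simp add: P_def W_def poly_jacobi_eq_form u_def v_def)
  have uu: "D * (E * (u * (u * P n))) =
      W (\<lambda>m. ((\<nu> - 1 + \<alpha> - m) * (\<nu> - 1 - m)) * ((\<nu> + \<alpha> - m) * (\<nu> - m))) (n + 2)"
    and uv': "D * (E * (v * (u * P n))) =
      W (\<lambda>m. ((\<nu> - 1 + \<alpha> - (m - 1)) * (\<nu> - 1 - (m - 1))) * (m * (\<beta> + m))) (n + 2)"
    and vv: "D * (E * (v * (v * P n))) =
      W (\<lambda>m. ((m - 1) * (\<beta> + (m - 1))) * (m * (\<beta> + m))) (n + 2)"
    by (simp_all only: P u1 u2 v1 v2 mult_1_left mult.left_commute[of E u "u * _"]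
      mult.left_commute[of E v "u * _"] mult.left_commute[of E v "v * _"])
  \<comment> \<open>homogenization: \<open>b x + d = (b - d) u + (b + d) v\<close> and \<open>1 = (v - u)\<^sup>2\<close>\<close>
  have "D * (a * P (n + 2) - (b * x + d) * P (n + 1) + E * e * P n) = 
    D * a * P (n + 2) + (- (b - d)) * (D * (u * P (n + 1))) + (- (b + d)) * (D * (v * P (n + 1)))
     + e * (D * (E * (u * (u * P n)))) + (- 2 * e) * (D * (E * (v * (u * P n))))
     + e * (D * (E * (v * (v * P n))))"
  proof -
    have "(b * x + d) = (b - d) * u + (b + d) * v"
      using uv by algebra
    moreover have "P n = (v - u) * (v - u) * P n"
      by (simp add: uv)
    ultimately show ?thesis
      by algebra
  qed
  also have "\<dots> = W (\<lambda>m. 0) (n + 2)"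
    unfolding uu uv' vv
    unfolding P u2 v2
    unfolding W_def weighted_jacobi_form_add weighted_jacobi_form_cmult
    by (rule arg_cong[of _ _ "\<lambda>f. weighted_jacobi_form \<alpha> \<beta> u v f (n + 2)"], rule ext)
       (simp add: D_def a_def b_def d_def e_def, algebra)
  also have "\<dots> = 0"
    by (simp add: W_def weighted_jacobi_form_def)
  finally have "a * P (n + 2) - (b * x + d) * P (n + 1) + E * e * P n = 0"
    using assms(2,3) by (simp add: D_def)
  then show ?thesis
    unfolding P_def a_def b_def d_def e_def E_def by algebra
qed

section \<open>Resultants as products of values\<close>

lemma poly_eq_prod_proots:
  "poly (p::complex poly) x = lead_coeff p * (\<Prod>b\<in>#proots p. x - b)"
proof -
  have "poly p x = poly (smult (lead_coeff p) (\<Prod>b\<in>#proots p. [:-b, 1:])) x"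
    by (simp add: complex_poly_decompose_multiset)
  then show ?thesis
    by (simp add: poly_prod_mset)
qed

lemma Res_eq_prod_left:
  "Res f g = lead_coeff f ^ degree g * (\<Prod>a\<in>#proots f. poly g a)"
  unfolding Res_def poly_eq_prod_proots[of g] prod_mset.distrib
  by (simp add: size_proots_complex)

lemma Res_eq_prod_right:
  "Res f g = (-1) ^ (degree f * degree g) * lead_coeff g ^ degree f * (\<Prod>b\<in>#proots g. poly f b)"
proof -
  have neg: "(\<Prod>a\<in>#A. (-1::complex) * h a) = (-1) ^ size A * prod_mset (image_mset h A)" for h and A :: "complex multiset"
    by (simp only: prod_mset.distrib) simp
  have "(\<Prod>a\<in>#proots f. \<Prod>b\<in>#proots g. a - b) = (\<Prod>b\<in>#proots g. \<Prod>a\<in>#proots f. a - b)"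
    by (rule prod_mset.swap)
  also have "\<dots> = (\<Prod>b\<in>#proots g. (-1) ^ degree f * (\<Prod>a\<in>#proots f. b - a))"
    using neg[of "\<lambda>a. _ - a" "proots f"] by (simp add: size_proots_complex)
  also have "\<dots> = (-1) ^ (degree f * degree g) * (\<Prod>b\<in>#proots g. \<Prod>a\<in>#proots f. b - a)"
    by (simp only: prod_mset.distrib) (simp add: size_proots_complex power_mult)
  finally show ?thesis
    unfolding Res_def poly_eq_prod_proots[of f] prod_mset.distrib
    by (simp add: size_proots_complex)
qed

text \<open>
  The values at the roots of \<open>g\<close> do not see multiples of \<open>g\<close>; the assumption keeps the exponent of
  the leading coefficient of \<open>g\<close> unchanged.
\<close>

lemma Res_add_smult:
  assumes "degree (f + smult c g) = degree f"
  shows "Res (f + smult c g) g = Res f g"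
proof -
  have "poly g b = 0" if "b \<in># proots g" for b
    using that by (cases "g = 0") auto
  then have "(\<Prod>b\<in>#proots g. poly (f + smult c g) b) = (\<Prod>b\<in>#proots g. poly f b)"
    by (intro arg_cong[of _ _ prod_mset] image_mset_cong) simp
  then show ?thesis
    by (simp add: Res_eq_prod_right assms)
qed

lemma Res_mult_on_roots:
  assumes "degree g = degree h" "\<And>x. poly f x = 0 \<Longrightarrow> poly g x = c x * poly h x"
  shows "Res f g = Res f h * (\<Prod>x\<in>#proots f. c x)"
proof -
  have "poly g x = c x * poly h x" if "x \<in># proots f" for x
    using that assms(2) by (cases "f = 0") auto
  then have "(\<Prod>x\<in>#proots f. poly g x) = (\<Prod>x\<in>#proots f. c x * poly h x)"
    by (intro arg_cong[of _ _ prod_mset] image_mset_cong)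
  then show ?thesis
    by (simp add: Res_eq_prod_left assms(1) prod_mset.distrib)
qed

section \<open>Leading coefficients\<close>

lemma degree_jacobi_le: "degree (jacobi \<alpha> \<beta> n) \<le> n"
  unfolding jacobi_def
proof (rule degree_sum_le)
  fix m assume "m \<in> {..n}"
  then have "degree ([:- 1/2, 1/2:] ^ (n - m) * [:1/2, 1/2:] ^ m :: 'a poly) \<le> (n - m) + m"
    by (intro order.trans[OF degree_mult_le] add_mono order.trans[OF degree_power_le]) auto
  then show "degree (smult (((of_nat n + \<alpha>) gchoose m) * ((of_nat n + \<beta>) gchoose (n - m)))
      ([:- 1/2, 1/2:] ^ (n - m) * [:1/2, 1/2:] ^ m)) \<le> n"
    using \<open>m \<in> {..n}\<close> by (intro order.trans[OF degree_smult_le]) auto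
qed simp

text \<open>
  Each of the products in the defining sum has top coefficient \<open>1 / 2 ^ n\<close>, so the top coefficient of
  the sum is a Vandermonde convolution.
\<close>

lemma coeff_jacobi_top:
  "coeff (jacobi \<alpha> \<beta> n) n = ((2 * of_nat n + \<alpha> + \<beta>) gchoose n) / 2 ^ n"
proof -
  have "coeff ([:- 1/2, 1/2:] ^ (n - m) * [:1/2, 1/2:] ^ m) n = (1 / 2 ^ n :: 'a)" if "m \<le> n" for m
  proof -
    have "degree ([:- 1/2, 1/2:] ^ (n - m) * [:1/2, 1/2:] ^ m :: 'a poly) = n"
      using that by (simp add: degree_mult_eq degree_power_eq)
    then have "coeff ([:- 1/2, 1/2:] ^ (n - m) * [:1/2, 1/2:] ^ m) n =
       lead_coeff ([:- 1/2, 1/2:] ^ (n - m) * [:1/2, 1/2:] ^ m :: 'a poly)"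
      by simp
    also have "\<dots> = (1/2) ^ (n - m) * (1/2) ^ m"
      by (simp add: lead_coeff_mult lead_coeff_power)
    also have "\<dots> = 1 / 2 ^ n"
      using that by (simp add: power_one_over flip: power_add)
    finally show ?thesis .
  qed
  then have "coeff (jacobi \<alpha> \<beta> n) n =
      (\<Sum>m=0..n. ((of_nat n + \<alpha>) gchoose m) * ((of_nat n + \<beta>) gchoose (n - m))) / 2 ^ n"
    by (simp add: jacobi_def coeff_sum sum_divide_distrib atMost_atLeast0)
  then show ?thesis
    unfolding gbinomial_Vandermonde by (simp add: algebra_simps)
qed

definition jacobi_lead :: "real \<Rightarrow> real \<Rightarrow> nat \<Rightarrow> real" where
  "jacobi_lead \<alpha> \<beta> n = (\<Prod>k=1..n. real n + real k + \<alpha> + \<beta>) / (2 ^ n * fact n)"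

lemma jacobi_lead_nonzero:
  assumes "\<alpha> > -1" "\<beta> > -1"
  shows "jacobi_lead \<alpha> \<beta> n \<noteq> 0"
proof -
  have "real n + real k + \<alpha> + \<beta> \<noteq> 0" if "k \<in> {1..n}" for k
  proof -
    have "1 \<le> real n" "1 \<le> real k" using that by auto
    then show ?thesis using assms by linarith
  qed
  then show ?thesis
    by (auto simp: jacobi_lead_def)
qed

lemma coeff_jacobi_top_real:
  "coeff (jacobi (complex_of_real \<alpha>) (of_real \<beta>) n) n = of_real (jacobi_lead \<alpha> \<beta> n)"
proof -
  let ?x = "2 * of_nat n + of_real \<alpha> + of_real \<beta> :: complex"
  have "fact n * (?x gchoose n) = (\<Prod>i=0..<n. ?x - of_nat i)"
    by (rule gbinomial_mult_fact)
  also have "\<dots> = (\<Prod>k=1..n. of_real (real n + real k + \<alpha> + \<beta>))"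
    by (rule prod.reindex_bij_witness[of _ "\<lambda>k. n - k" "\<lambda>i. n - i"])
       (auto simp: of_nat_diff)
  finally have "(?x gchoose n) = of_real ((\<Prod>k=1..n. real n + real k + \<alpha> + \<beta>) / fact n)"
    by (simp add: field_simps)
  then show ?thesis
    by (simp add: coeff_jacobi_top jacobi_lead_def mult.commute)
qed

lemma
  assumes "\<alpha> > -1" "\<beta> > -1"
  shows degree_jacobi: "degree (jacobi (complex_of_real \<alpha>) (of_real \<beta>) n) = n"
    and lead_coeff_jacobi:
      "lead_coeff (jacobi (complex_of_real \<alpha>) (of_real \<beta>) n) = of_real (jacobi_lead \<alpha> \<beta> n)"
proof -
  have "coeff (jacobi (complex_of_real \<alpha>) (of_real \<beta>) n) n \<noteq> 0"
    by (simp add: coeff_jacobi_top_real jacobi_lead_nonzero assms)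
  then show "degree (jacobi (complex_of_real \<alpha>) (of_real \<beta>) n) = n"
    using degree_jacobi_le le_degree by (intro antisym) blast+
  then show "lead_coeff (jacobi (complex_of_real \<alpha>) (of_real \<beta>) n) = of_real (jacobi_lead \<alpha> \<beta> n)"
    by (simp add: coeff_jacobi_top_real)
qed

lemma
  assumes "\<alpha> > -1" "\<beta> > -1" "n \<ge> 1"
  shows degree_quasi_jacobi: "degree (quasi_jacobi (complex_of_real \<alpha>) (of_real \<beta>) c n) = n"
    and lead_coeff_quasi_jacobi: "lead_coeff (quasi_jacobi (complex_of_real \<alpha>) (of_real \<beta>) c n) =
      of_real (jacobi_lead \<alpha> \<beta> n)"
proof -
  let ?P = "jacobi (complex_of_real \<alpha>) (of_real \<beta>)"
  have less: "degree (smult c (?P (n - 1))) < degree (?P n)"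
    using assms by (intro le_less_trans[OF degree_smult_le]) (simp add: degree_jacobi)
  show "degree (quasi_jacobi (complex_of_real \<alpha>) (of_real \<beta>) c n) = n"
    unfolding quasi_jacobi_def using less assms by (simp add: degree_add_eq_left degree_jacobi)
  show "lead_coeff (quasi_jacobi (complex_of_real \<alpha>) (of_real \<beta>) c n) =
      of_real (jacobi_lead \<alpha> \<beta> n)"
    unfolding quasi_jacobi_def using less assms
    by (metis add.commute lead_coeff_add_le lead_coeff_jacobi)
qed

section \<open>Resultants of consecutive Jacobi polynomials\<close>

lemma of_nat_add_2_of_real_nonzero:
  assumes "y > -1"
  shows "of_nat n + 2 + complex_of_real y \<noteq> 0"
proof -
  have "of_nat n + 2 + complex_of_real y = of_real (real n + 2 + y)" by simp
  moreover have "real n + 2 + y \<noteq> 0" using assms by linarith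
  ultimately show ?thesis by (metis of_real_eq_0_iff)
qed

text \<open>
  At a root of \<open>P (n + 1)\<close> the middle term of the recurrence drops out, and \<open>P (n + 2)\<close> is a constant
  multiple of \<open>P n\<close>. Evaluating both resultants at the \<open>n + 1\<close> roots of \<open>P (n + 1)\<close> gives the power of this
  constant; the square of the leading coefficient is what remains of its exponents \<open>n + 2\<close> on the left and
  \<open>n\<close> on the right.
\<close>

lemma Res_jacobi_step:
  fixes \<alpha> \<beta> :: real and n :: nat
  defines "P \<equiv> jacobi (complex_of_real \<alpha>) (of_real \<beta>)"
  assumes ab: "\<alpha> > -1" "\<beta> > -1"
  shows "Res (P (n + 2)) (P (n + 1)) =
    of_real ((jacobi_lead \<alpha> \<beta> (n + 1))\<^sup>2 *
      (- ((real n + 1 + \<alpha>) * (real n + 1 + \<beta>) * (2 * real n + 4 + \<alpha> + \<beta>) /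
         ((real n + 2) * (real n + 2 + \<alpha> + \<beta>) * (2 * real n + 2 + \<alpha> + \<beta>)))) ^ (n + 1)) *
    Res (P (n + 1)) (P n)"
    (is "_ = of_real (_ * ?c ^ _) * _")
proof -
  have root: "poly (P (n + 2)) x = of_real ?c * poly (P n) x" if "x \<in># proots (P (n + 1))" for x
  proof -
    have P0: "poly (P (n + 1)) x = 0"
      using that by (cases "P (n + 1) = 0") auto
    from jacobi_recurrence[OF of_nat_add_2_of_real_nonzero[of _ n] of_nat_add_2_of_real_nonzero[of _ n], OF ab, of x]
    have "of_real (2 * ((real n + 2) * (real n + 2 + \<alpha> + \<beta>) * (2 * real n + 2 + \<alpha> + \<beta>))) * poly (P (n + 2)) x
      = - of_real (2 * ((real n + 1 + \<alpha>) * (real n + 1 + \<beta>) * (2 * real n + 4 + \<alpha> + \<beta>))) * poly (P n) x"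
      unfolding P_def[symmetric] P0 by (simp add: algebra_simps)
    moreover have "(real n + 2) * (real n + 2 + \<alpha> + \<beta>) * (2 * real n + 2 + \<alpha> + \<beta>) \<noteq> 0"
      using ab by auto
    moreover have "Y = of_real (- (p / q)) * X"
      if "of_real (2 * q) * Y = - of_real (2 * p) * X" "q \<noteq> 0" for p q :: real and X Y :: complex
      using that by (simp add: field_simps)
    ultimately show ?thesis
      by blast
  qed
  have "(\<Prod>x\<in>#proots (P (n + 1)). poly (P (n + 2)) x) =
      (\<Prod>x\<in>#proots (P (n + 1)). of_real ?c * poly (P n) x)"
    using root by (intro arg_cong[of _ _ prod_mset] image_mset_cong)
  also have "\<dots> = of_real ?c ^ (n + 1) * (\<Prod>x\<in>#proots (P (n + 1)). poly (P n) x)"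
    unfolding prod_mset.distrib using ab by (simp add: size_proots_complex P_def degree_jacobi)
  finally have prod: "(\<Prod>x\<in>#proots (P (n + 1)). poly (P (n + 2)) x) =
      of_real ?c ^ (n + 1) * (\<Prod>x\<in>#proots (P (n + 1)). poly (P n) x)" .
  have "even ((n + 2) * (n + 1))" by simp
  then have sgn: "(-1 :: complex) ^ ((n + 2) * (n + 1)) = 1"
    by (rule neg_one_even_power)
  have deg: "degree (P k) = k" "coeff (P k) k = of_real (jacobi_lead \<alpha> \<beta> k)" for k
    unfolding P_def by (rule degree_jacobi coeff_jacobi_top_real; fact)+
  show ?thesis
    unfolding Res_eq_prod_right[of "P (n + 2)"] Res_eq_prod_left[of "P (n + 1)"] deg prod sgn
    by (simp only: power_add of_real_mult of_real_power mult_1_left mult_ac)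
qed

text \<open>
  Passing from \<open>n + 1\<close> to \<open>n + 2\<close> in the factors \<open>(n + k + \<alpha> + \<beta>) ^ (n - k - 1)\<close> of the
  resultant: written by the value \<open>j\<close> of the argument of \<open>h\<close>, the exponent of \<open>h j\<close> goes up by two for
  every \<open>j\<close> from \<open>n + 2\<close> to \<open>2 n + 2\<close>, apart from the two endpoints, which the extra factors on the left
  correct.
\<close>

lemma prod_shift_powers:
  fixes h :: "nat \<Rightarrow> 'a::comm_semiring_1"
  shows "(\<Prod>k=1..n+1. h (n + 2 + k) ^ (n + 1 - k)) * h (n + 2) ^ (n + 1) * h (2 * n + 2) =
    (\<Prod>k=1..n. h (n + 1 + k) ^ (n - k)) * (\<Prod>k=1..n+1. h (n + 1 + k))\<^sup>2"
proof -
  have "(\<Prod>k=1..n+1. h (n + 2 + k) ^ (n + 1 - k)) * h (n + 2) ^ (n + 1) =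
      (\<Prod>k=Suc 0..Suc (n+1). h (n + 1 + k) ^ (n + 2 - k))"
    by (subst prod.atLeast_Suc_atMost, simp, subst prod.shift_bounds_cl_Suc_ivl)
       (simp add: mult.commute del: prod.cl_ivl_Suc)
  also have "\<dots> = (\<Prod>k=1..n. h (n + 1 + k) ^ (n + 2 - k)) * h (2 * n + 2)"
    by (simp add: mult_2)
  also have "(\<Prod>k=1..n. h (n + 1 + k) ^ (n + 2 - k)) =
      (\<Prod>k=1..n. h (n + 1 + k) ^ (n - k)) * (\<Prod>k=1..n. h (n + 1 + k))\<^sup>2"
    unfolding prod_power_distrib prod.distrib[symmetric]
    by (intro prod.cong refl) (simp add: Suc_diff_le power2_eq_square mult_ac flip: power_add)
  finally show ?thesis
    by (simp add: power2_eq_square mult_2 mult_2_right mult_ac)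
qed

lemma prod_powi_Suc:
  "(\<Prod>k=1..n+1. real k powi (int k - 2 * int (n + 1) + 1)) =
    (\<Prod>k=1..n. real k powi (int k - 2 * int n + 1)) / ((real n + 1) ^ n * (fact n)\<^sup>2)"
proof -
  have "(\<Prod>k=1..n. real k powi (int k - 2 * int (n + 1) + 1)) =
      (\<Prod>k=1..n. real k powi (int k - 2 * int n + 1) / (real k)\<^sup>2)"
  proof (intro prod.cong refl)
    fix k assume "k \<in> {1..n}"
    then have "real k powi ((int k - 2 * int n + 1) - 2) = real k powi (int k - 2 * int n + 1) / (real k)\<^sup>2"
      by (subst power_int_diff) auto
    then show "real k powi (int k - 2 * int (n + 1) + 1) = real k powi (int k - 2 * int n + 1) / (real k)\<^sup>2"
      by (simp add: algebra_simps)
  qed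
  also have "\<dots> = (\<Prod>k=1..n. real k powi (int k - 2 * int n + 1)) / (fact n)\<^sup>2"
    by (simp add: prod_dividef fact_prod flip: prod_power_distrib)
  moreover have "real (n + 1) powi (int (n + 1) - 2 * int (n + 1) + 1) = 1 / (real n + 1) ^ n"
  proof -
    have "int (n + 1) - 2 * int (n + 1) + 1 = - int n" by simp
    then show ?thesis
      by (simp only: power_int_minus power_int_of_nat) (simp add: field_simps)
  qed
  ultimately show ?thesis
    by simp
qed

text \<open>
  The closed form of \<open>Res (P n) (P (n - 1))\<close>, for \<open>n \<ge> 1\<close>.
\<close>

definition jacobi_res :: "real \<Rightarrow> real \<Rightarrow> nat \<Rightarrow> real" where
  "jacobi_res \<alpha> \<beta> n = (-1) ^ (n * (n - 1) div 2) * (2 * real n + \<alpha> + \<beta>) ^ (n - 1) / 2 ^ (n * (n - 1))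
     * (\<Prod>k=1..n. real k powi (int k - 2 * int n + 1))
     * (\<Prod>k=1..n-1. (real k + \<alpha>) ^ k * (real k + \<beta>) ^ k
          * (real n + real k + \<alpha> + \<beta>) ^ (n - k - 1))"

lemma triangle_parity: "(-1::'a::ring_1) ^ ((n + 2) * (n + 1) div 2) = (-1) ^ ((n + 1) * n div 2) * (-1) ^ (n + 1)"
proof -
  have "(n + 2) * (n + 1) div 2 = (n + 1) * n div 2 + (n + 1)"
  proof -
    have "(n + 2) * (n + 1) = (n + 1) * n + (n + 1) * 2" by (simp add: algebra_simps)
    then show ?thesis by (simp only: div_mult_self1)
  qed
  then show ?thesis by (simp add: power_add)
qed

text \<open>
  The two products over \<open>k\<close> with exponents depending on \<open>n\<close> are compared by \<open>prod_powi_Suc\<close> and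
  \<open>prod_shift_powers\<close>; the factorial and the product \<open>Q\<close> that they produce squared are exactly those
  of the squared leading coefficient, and all else cancels.
\<close>

lemma jacobi_res_step:
  assumes "\<alpha> > -1" "\<beta> > -1"
  shows "jacobi_res \<alpha> \<beta> (n + 2) = (jacobi_lead \<alpha> \<beta> (n + 1))\<^sup>2 *
      (- ((real n + 1 + \<alpha>) * (real n + 1 + \<beta>) * (2 * real n + 4 + \<alpha> + \<beta>) /
         ((real n + 2) * (real n + 2 + \<alpha> + \<beta>) * (2 * real n + 2 + \<alpha> + \<beta>)))) ^ (n + 1) *
      jacobi_res \<alpha> \<beta> (n + 1)"
proof -
  define h where "h j = real j + \<alpha> + \<beta>" for j
  define S0 where "S0 = (\<Prod>k=1..n. h (n + 1 + k) ^ (n - k))"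
  define S1 where "S1 = (\<Prod>k=1..n+1. h (n + 2 + k) ^ (n + 1 - k))"
  define Q where "Q = (\<Prod>k=1..n+1. h (n + 1 + k))"
  define Z where "Z = (\<Prod>k=1..n. (real k + \<alpha>) ^ k * (real k + \<beta>) ^ k)"
  define K where "K = (\<Prod>k=1..n+1. real k powi (int k - 2 * int (n + 1) + 1))"
  define A B where "A = real n + 1 + \<alpha>" and "B = real n + 1 + \<beta>"
  define N where "N = n + 1"
  define sg where "sg = (-1::real) ^ ((n + 1) * n div 2)"
  have pos: "h (n + 2) > 0" "h (2 * n + 2) > 0" "h (2 * n + 4) > 0"
    using assms by (auto simp: h_def)
  have S: "S1 = S0 * Q\<^sup>2 / (h (n + 2) ^ N * h (2 * n + 2))"
    using prod_shift_powers[of h n] pos unfolding S0_def S1_def Q_def N_def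
    by (simp add: field_simps)
  have r0: "jacobi_res \<alpha> \<beta> (n + 1) = sg * h (2 * n + 2) ^ n / 2 ^ (N * n) * K * (Z * S0)"
    unfolding jacobi_res_def sg_def K_def Z_def S0_def N_def prod.distrib
    by (simp add: h_def add_ac)
  have r1: "jacobi_res \<alpha> \<beta> (n + 2) =
      sg * (-1) ^ N * h (2 * n + 4) ^ N / 2 ^ ((n + 2) * N) * (K / ((real n + 2) ^ N * (fact N)\<^sup>2)) *
      (Z * (A ^ N * B ^ N) * S1)"
  proof -
    have "(\<Prod>k=1..n+2. real k powi (int k - 2 * int (n + 2) + 1)) = K / ((real n + 2) ^ N * (fact N)\<^sup>2)"
      using prod_powi_Suc[of "n + 1"] unfolding K_def N_def by (simp add: add_ac)
    moreover have "(\<Prod>k=1..n+1. (real k + \<alpha>) ^ k * (real k + \<beta>) ^ k) = Z * (A ^ N * B ^ N)"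
      by (simp add: Z_def A_def B_def N_def add_ac)
    moreover have "(\<Prod>k=1..n+1. (real (n + 2) + real k + \<alpha> + \<beta>) ^ (n + 2 - k - 1)) = S1"
      unfolding S1_def h_def by (simp add: add_ac)
    moreover have "(-1) ^ ((n + 2) * (n + 2 - 1) div 2) = sg * (-1) ^ N"
      using triangle_parity[of n, where 'a = real] by (simp add: sg_def N_def)
    moreover have "n + 2 - 1 = N" "2 * real (n + 2) + \<alpha> + \<beta> = h (2 * n + 4)"
      by (simp_all add: N_def h_def)
    ultimately show ?thesis
      unfolding jacobi_res_def prod.distrib by (simp add: N_def)
  qed
  have lead: "jacobi_lead \<alpha> \<beta> (n + 1) = Q / (2 ^ N * fact N)"
    by (simp add: jacobi_lead_def Q_def h_def N_def add_ac)
  have eqs: "real n + 1 + \<alpha> = A" "real n + 1 + \<beta> = B" "2 * real n + 4 + \<alpha> + \<beta> = h (2 * n + 4)"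
      "real n + 2 + \<alpha> + \<beta> = h (n + 2)" "2 * real n + 2 + \<alpha> + \<beta> = h (2 * n + 2)" "n + 1 = N"
    by (simp_all add: A_def B_def h_def N_def)
  have two: "(2::real) ^ ((n + 2) * N) = 2 ^ (N * n) * 2 ^ N * 2 ^ N"
    by (simp add: algebra_simps flip: power_add)
  have hN: "h (2 * n + 2) ^ N = h (2 * n + 2) ^ n * h (2 * n + 2)"
    by (simp add: N_def)
  have neg: "(- (x / y)) ^ N = (-1) ^ N * (x ^ N / y ^ N)" for x y :: real
    by (metis mult_minus1 power_divide power_mult_distrib)
  show ?thesis
    unfolding r1 r0[unfolded eqs(6)] lead[unfolded eqs(6)] eqs neg S two power_mult_distrib hN power_divide
    using pos by (simp add: field_simps power2_eq_square)
qed

lemma Res_jacobi: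
  assumes "\<alpha> > -1" "\<beta> > -1"
  shows "Res (jacobi (of_real \<alpha>) (of_real \<beta>) (n + 1)) (jacobi (of_real \<alpha>) (of_real \<beta>) n) =
    of_real (jacobi_res \<alpha> \<beta> (n + 1))"
proof (induction n)
  case 0
  have "jacobi (complex_of_real \<alpha>) (of_real \<beta>) 0 = 1"
    by (simp add: jacobi_def)
  then show ?case
    by (simp add: Res_eq_prod_left jacobi_res_def)
next
  case (Suc n)
  have "Res (jacobi (of_real \<alpha>) (of_real \<beta>) (n + 2)) (jacobi (of_real \<alpha>) (of_real \<beta>) (n + 1)) =
      of_real (jacobi_res \<alpha> \<beta> (n + 2))"
    unfolding Res_jacobi_step[OF assms] jacobi_res_step[OF assms] Suc.IH by (simp only: of_real_mult)
  then show ?case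
    by simp
qed

lemma Res_quasi_jacobi_jacobi:
  assumes "\<alpha> > -1" "\<beta> > -1"
  shows "Res (quasi_jacobi (of_real \<alpha>) (of_real \<beta>) s (n + 1)) (jacobi (of_real \<alpha>) (of_real \<beta>) n) =
    of_real (jacobi_res \<alpha> \<beta> (n + 1))"
proof -
  have "degree (quasi_jacobi (complex_of_real \<alpha>) (of_real \<beta>) s (n + 1)) =
      degree (jacobi (complex_of_real \<alpha>) (of_real \<beta>) (n + 1))"
    using assms by (simp only: degree_jacobi degree_quasi_jacobi le_add2)
  then show ?thesis
    unfolding quasi_jacobi_def using Res_add_smult Res_jacobi[OF assms] by simp
qed

section \<open>The affine factor and the continuation to the origin\<close>

text \<open>
  The left side is the constant of the first formula of the theorem. On the right, the quotient by the
  leading coefficient accounts for \<open>f\<close> being the product of its linear factors times that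
  coefficient, and the last factor is the power of minus the slope of \<open>L\<close> that comes out of
  \<open>\<Prod>x. 1 + t L x\<close> when each affine factor is normalized.
\<close>

lemma jacobi_res_rescaled:
  assumes "\<alpha> > -1" "\<beta> > -1" "n \<ge> 2"
  shows "(-1) ^ (n * (n + 1) div 2) * (2 * real n + \<alpha> + \<beta>) ^ (n - 2)
           * (2 * real n + \<alpha> + \<beta> - 1) ^ n * (2 * real n + \<alpha> + \<beta> - 2) ^ n
         / (2 ^ (n * (n - 1)) * (real n + \<alpha> - 1) ^ n * (real n + \<beta> - 1) ^ n)
         * (\<Prod>k=1..n. real k powi (int k - 2 * int n + 2))
         * (\<Prod>k=1..n-1. (real k + \<alpha>) ^ k * (real k + \<beta>) ^ k
              * (real n + real k + \<alpha> + \<beta>) powi (int n - int k - 2)) =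
    jacobi_res \<alpha> \<beta> n / jacobi_lead \<alpha> \<beta> n *
      (- ((2 * real n + \<alpha> + \<beta> - 1) * (2 * real n + \<alpha> + \<beta> - 2) /
        (2 * ((real n + \<alpha> - 1) * (real n + \<beta> - 1))))) ^ n"
proof -
  define H where "H k = real n + real k + \<alpha> + \<beta>" for k
  define p q r where "p = 2 * real n + \<alpha> + \<beta>" and "q = p - 1" and "r = p - 2"
  define A B where "A = real n + \<alpha> - 1" and "B = real n + \<beta> - 1"
  define Z where "Z = (\<Prod>k=1..n-1. (real k + \<alpha>) ^ k * (real k + \<beta>) ^ k)"
  define K where "K = (\<Prod>k=1..n. real k powi (int k - 2 * int n + 1))"
  define S where "S = (\<Prod>k=1..n-1. H k ^ (n - k - 1))"
  define Q where "Q = (\<Prod>k=1..n-1. H k)"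
  define sg where "sg = (-1::real) ^ (n * (n - 1) div 2)"
  obtain m where n: "n = m + 2"
    using assms(3) that[of "n - 2"] by simp
  have H: "H k > 0" for k
    using assms by (simp add: H_def n)
  then have Q: "Q > 0"
    by (auto simp: Q_def intro: prod_pos)
  have pos: "p > 0" "A > 0" "B > 0"
    using assms by (simp_all add: p_def A_def B_def n)
  have "(\<Prod>k=1..n. real k powi (int k - 2 * int n + 2)) =
      (\<Prod>k=1..n. real k powi (int k - 2 * int n + 1) * real k)"
  proof (intro prod.cong refl)
    fix k assume "k \<in> {1..n}"
    then show "real k powi (int k - 2 * int n + 2) = real k powi (int k - 2 * int n + 1) * real k"
      using power_int_add_1[of "real k" "int k - 2 * int n + 1"] by (simp add: add_ac)
  qed
  then have K': "(\<Prod>k=1..n. real k powi (int k - 2 * int n + 2)) = K * fact n"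
    by (simp add: prod.distrib K_def fact_prod)
  have "(\<Prod>k=1..n-1. H k powi (int n - int k - 2)) = (\<Prod>k=1..n-1. H k ^ (n - k - 1) / H k)"
  proof (intro prod.cong refl)
    fix k assume "k \<in> {1..n-1}"
    then have "int n - int k - 2 = int (n - k - 1) - 1" using n by auto
    moreover have "H k powi (int (n - k - 1) - 1) = H k ^ (n - k - 1) / H k"
      using H[of k] by (subst power_int_diff) auto
    ultimately show "H k powi (int n - int k - 2) = H k ^ (n - k - 1) / H k"
      by (simp only:)
  qed
  then have S': "(\<Prod>k=1..n-1. H k powi (int n - int k - 2)) = S / Q"
    by (simp add: prod_dividef S_def Q_def)
  have sg': "(-1::real) ^ (n * (n + 1) div 2) = sg * (-1) ^ n"
    using triangle_parity[of "n - 1", where 'a = real] n by (simp add: sg_def mult.commute)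
  have lead: "jacobi_lead \<alpha> \<beta> n = Q * p / (2 ^ n * fact n)"
  proof -
    have "(\<Prod>k=1..n. H k) = Q * p"
      unfolding Q_def p_def by (simp add: n H_def)
    then show ?thesis by (simp add: jacobi_lead_def H_def)
  qed
  have res: "jacobi_res \<alpha> \<beta> n = sg * (p ^ (n - 2) * p) / 2 ^ (n * (n - 1)) * K * (Z * S)"
    unfolding jacobi_res_def prod.distrib sg_def K_def Z_def S_def H_def p_def by (simp add: n)
  have neg: "(- (x / y)) ^ n = (-1) ^ n * (x ^ n / y ^ n)" for x y :: real
    by (metis mult_minus1 power_divide power_mult_distrib)
  have cancel: "sg' * e * P * q' * r' / (T * A' * B') * (K * F) * (Z * (S / Q)) =
      sg' * (P * p) / T * K * (Z * S) / (Q * p / (D * F)) * (e * (q' * r' / (D * (A' * B'))))"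
    if "T \<noteq> 0" "A' \<noteq> 0" "B' \<noteq> 0" "D \<noteq> 0" "F \<noteq> 0"
    for sg' e P q' r' T A' B' F D :: real
    using that pos(1) Q by (simp add: divide_simps)
  have "sg * (-1) ^ n * p ^ (n - 2) * q ^ n * r ^ n / (2 ^ (n * (n - 1)) * A ^ n * B ^ n)
        * (K * fact n) * (Z * (S / Q)) =
    sg * (p ^ (n - 2) * p) / 2 ^ (n * (n - 1)) * K * (Z * S) / (Q * p / (2 ^ n * fact n)) *
      (- (q * r / (2 * (A * B)))) ^ n"
    unfolding neg power_mult_distrib by (rule cancel) (use pos in auto)
  then show ?thesis
    unfolding res lead prod.distrib S'[unfolded H_def] K' sg' Z_def[unfolded prod.distrib, symmetric]
    unfolding p_def[symmetric] q_def[symmetric] r_def[symmetric] A_def[symmetric] B_def[symmetric] .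
qed

text \<open>
  This locates the zero, in \<open>x\<close>, of \<open>1 + u L x\<close> for the affine function \<open>L\<close> obtained from the recurrence.
  In the application \<open>p\<close>, \<open>q\<close>, \<open>r\<close> are \<open>2 n + \<alpha> + \<beta>\<close> diminished by 0, 1, 2, further
  \<open>w = (n + \<alpha> - 1) (n + \<beta> - 1)\<close>, \<open>z = n (n + \<alpha> + \<beta>)\<close> and \<open>\<delta> = \<alpha>\<^sup>2 - \<beta>\<^sup>2\<close>.
\<close>

lemma affine_factor_root: 
  fixes p q r w z \<delta> s u x :: "'a::field_char_0"
  assumes "p \<noteq> 0" "q \<noteq> 0" "r \<noteq> 0" "w \<noteq> 0" "u \<noteq> 0"
  shows "1 + u * ((q * (p * r * x + \<delta>) + 2 * z * r * s) / (2 * w * p)) =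
    - (q * r / (2 * w)) * u * ((- (2 * w / (q * r * u)) - \<delta> / (p * r) - 2 * z * s / (p * q)) - x)"
  using assms by (simp add: field_simps)

text \<open>
  For \<open>u \<noteq> 0\<close> the point \<open>X u\<close> is the zero of \<open>1 + u L x\<close>, so the product of these factors over the roots
  of \<open>f\<close> is a multiple of \<open>u ^ degree f * poly f (X u)\<close>. The product is a polynomial in \<open>u\<close> and thus
  identifies the continuation to \<open>u = 0\<close> without expanding \<open>f\<close>.
\<close>

lemma poly_extension_affine:
  assumes "\<And>u x. u \<noteq> 0 \<Longrightarrow> 1 + u * L x = K * u * (X u - x)" "K \<noteq> 0"
  shows "poly_extension (\<lambda>u. u ^ degree f * poly f (X u)) =
    smult (lead_coeff f / K ^ degree f) (\<Prod>x\<in>#proots f. [:1, L x:])"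
proof (rule poly_extension_eqI)
  fix u :: complex assume "u \<noteq> 0"
  then have "(\<Prod>x\<in>#proots f. 1 + u * L x) = (\<Prod>x\<in>#proots f. (K * u) * (X u - x))"
    using assms(1) by simp
  also have "\<dots> = K ^ degree f * (u ^ degree f * (\<Prod>x\<in>#proots f. X u - x))"
    unfolding prod_mset.distrib by (simp add: size_proots_complex power_mult_distrib)
  finally have prod: "(\<Prod>x\<in>#proots f. 1 + u * L x) =
      K ^ degree f * (u ^ degree f * (\<Prod>x\<in>#proots f. X u - x))" .
  show "poly (smult (lead_coeff f / K ^ degree f) (\<Prod>x\<in>#proots f. [:1, L x:])) u =
      u ^ degree f * poly f (X u)"
    unfolding poly_eq_prod_proots[of f "X u"] using assms(2)
    by (simp add: poly_prod_mset prod)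
qed

theorem theorem3p2:
  fixes \<alpha> \<beta> :: real and s t :: complex and n :: nat
  assumes "\<alpha> > -1" and "\<beta> > -1" and "n \<ge> 2"
  shows
   "Res (quasi_jacobi (of_real \<alpha>) (of_real \<beta>) s n) (quasi_jacobi (of_real \<alpha>) (of_real \<beta>) t (n - 1))
    = of_real
        ((-1) ^ (n * (n + 1) div 2) * (2 * real n + \<alpha> + \<beta>) ^ (n - 2)
           * (2 * real n + \<alpha> + \<beta> - 1) ^ n * (2 * real n + \<alpha> + \<beta> - 2) ^ n
         / (2 ^ (n * (n - 1)) * (real n + \<alpha> - 1) ^ n * (real n + \<beta> - 1) ^ n)
         * (\<Prod>k=1..n. real k powi (int k - 2 * int n + 2))
         * (\<Prod>k=1..n-1. (real k + \<alpha>) ^ k * (real k + \<beta>) ^ k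
              * (real n + real k + \<alpha> + \<beta>) powi (int n - int k - 2)))
      * poly (poly_extension (\<lambda>u. u ^ n *
          poly (quasi_jacobi (of_real \<alpha>) (of_real \<beta>) s n)
            (- (of_real (2 * (real n + \<alpha> - 1) * (real n + \<beta> - 1))
                 / (of_real ((2 * real n + \<alpha> + \<beta> - 1) * (2 * real n + \<alpha> + \<beta> - 2)) * u))
             - of_real ((\<alpha>\<^sup>2 - \<beta>\<^sup>2) / ((2 * real n + \<alpha> + \<beta>) * (2 * real n + \<alpha> + \<beta> - 2)))
             - of_real (2 * real n * (real n + \<alpha> + \<beta>)) * s
                 / of_real ((2 * real n + \<alpha> + \<beta>) * (2 * real n + \<alpha> + \<beta> - 1))))) t
    \<and>
    Res (quasi_jacobi (of_real \<alpha>) (of_real \<beta>) s n) (jacobi (of_real \<alpha>) (of_real \<beta>) (n - 1))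
    = of_real
        ((-1) ^ (n * (n - 1) div 2) * (2 * real n + \<alpha> + \<beta>) ^ (n - 1) / 2 ^ (n * (n - 1))
         * (\<Prod>k=1..n. real k powi (int k - 2 * int n + 1))
         * (\<Prod>k=1..n-1. (real k + \<alpha>) ^ k * (real k + \<beta>) ^ k
              * (real n + real k + \<alpha> + \<beta>) ^ (n - k - 1)))"
    (is "Res ?f ?g = of_real ?C * poly (poly_extension (\<lambda>u. u ^ n * poly ?f (?X u))) t \<and> ?second")
proof
  obtain m where n: "n = m + 2"
    using assms(3) that[of "n - 2"] by simp
  define P where "P = jacobi (complex_of_real \<alpha>) (of_real \<beta>)"
  have second: "Res ?f (P (n - 1)) = of_real (jacobi_res \<alpha> \<beta> n)"
    using Res_quasi_jacobi_jacobi[OF assms(1,2), of s "n - 1"] by (simp add: P_def n)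
  then show ?second
    unfolding P_def jacobi_res_def .

  define p q r w where "p = 2 * real n + \<alpha> + \<beta>" and "q = p - 1" and "r = p - 2"
    and "w = (real n + \<alpha> - 1) * (real n + \<beta> - 1)"
  define z \<delta> where "z = real n * (real n + \<alpha> + \<beta>)" and "\<delta> = \<alpha>\<^sup>2 - \<beta>\<^sup>2"
  have nz: "p \<noteq> 0" "q \<noteq> 0" "r \<noteq> 0" "w \<noteq> 0"
    using assms by (auto simp: p_def q_def r_def w_def n)
  define L where "L x = (of_real q * (of_real p * of_real r * x + of_real \<delta>) + 2 * of_real z * of_real r * s) /
    (2 * of_real w * of_real p)" for x :: complex
  define K where "K = - (q * r / (2 * w))"
  define a where "a = jacobi_lead \<alpha> \<beta> n"

  have root: "poly ?g x = (1 + t * L x) * poly (P (n - 1)) x" if "poly ?f x = 0" for x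
  proof -
    \<comment> \<open>substituting this for \<open>P n\<close> in the recurrence makes \<open>P (n - 2) x\<close> proportional to \<open>P (n - 1) x\<close>\<close>
    have top: "poly (P n) x = - s * poly (P (n - 1)) x"
      using that by (simp add: quasi_jacobi_def P_def eq_neg_iff_add_eq_0)
    from jacobi_recurrence[OF of_nat_add_2_of_real_nonzero[of _ m] of_nat_add_2_of_real_nonzero[of _ m], OF assms(1,2), of x]
    have "2 * of_real z * of_real r * poly (P n) x =
        of_real q * (of_real p * of_real r * x + of_real \<delta>) * poly (P (n - 1)) x
        - 2 * of_real w * of_real p * poly (P m) x"
      unfolding P_def[symmetric] by (simp add: z_def r_def q_def p_def \<delta>_def w_def n algebra_simps)
    then have "2 * of_real w * of_real p * poly (P m) x =
        (of_real q * (of_real p * of_real r * x + of_real \<delta>) + 2 * of_real z * of_real r * s) *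
          poly (P (n - 1)) x"
      unfolding top by (simp add: algebra_simps)
    then have "poly (P m) x = L x * poly (P (n - 1)) x"
      using nz by (simp add: L_def field_simps)
    then show ?thesis
      by (simp add: quasi_jacobi_def P_def n algebra_simps)
  qed
  have deg: "degree ?f = n" "degree ?g = degree (P (n - 1))"
    using assms by (simp_all add: degree_quasi_jacobi P_def degree_jacobi)
  have lead: "lead_coeff ?f = of_real a"
    unfolding a_def using assms by (intro lead_coeff_quasi_jacobi) auto
  have factored: "Res ?f ?g = of_real (jacobi_res \<alpha> \<beta> n) * (\<Prod>x\<in>#proots ?f. 1 + t * L x)"
    using Res_mult_on_roots[OF deg(2) root] second by simp

  have "1 + u * L x = of_real K * u * (?X u - x)" if "u \<noteq> 0" for u x
  proof -
    have "?X u = - (2 * of_real w / (of_real q * of_real r * u)) - of_real \<delta> / (of_real p * of_real r)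
        - 2 * of_real z * s / (of_real p * of_real q)"
      by (simp add: w_def q_def r_def p_def \<delta>_def z_def mult.assoc)
    then show ?thesis
      using affine_factor_root[of "of_real p" "of_real q" "of_real r" "of_real w" u x "of_real \<delta>" "of_real z" s]
        nz that unfolding L_def K_def by simp
  qed
  moreover have "K \<noteq> 0"
    using nz by (simp add: K_def)
  ultimately have ext: "poly_extension (\<lambda>u. u ^ n * poly ?f (?X u)) =
      smult (of_real a / of_real K ^ n) (\<Prod>x\<in>#proots ?f. [:1, L x:])"
    using poly_extension_affine[of L "of_real K" ?X ?f] unfolding deg(1) lead[unfolded deg(1)] by simp
  have C: "?C = jacobi_res \<alpha> \<beta> n / a * K ^ n"
    unfolding jacobi_res_rescaled[OF assms] a_def K_def w_def q_def r_def p_def ..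
  have "of_real ?C * (of_real a / of_real K ^ n) = complex_of_real (jacobi_res \<alpha> \<beta> n)"
    unfolding C using \<open>K \<noteq> 0\<close> jacobi_lead_nonzero[OF assms(1,2), of n] by (simp add: a_def)
  then show "Res ?f ?g = of_real ?C * poly (poly_extension (\<lambda>u. u ^ n * poly ?f (?X u))) t"
    unfolding ext factored poly_smult poly_prod_mset mult.assoc[symmetric] by simp
qed

end
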